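(* Let $A\in\mathbb{R}^{m\times n}$ with $m\ge n$ and $b\in\mathbb{R}^m$. Let $\sigma_n$ be the smallest singular value of $A$ and $\widetilde{\sigma}_{n+1}$ the smallest singular value of $[A,b]$, and assume $\widetilde{\sigma}_{n+1}<\sigma_n$. Let $\widetilde{M}=A^TA-\widetilde{\sigma}_{n+1}^2I_n$, let $x=x(A,b)=\widetilde{M}^{-1}A^Tb$ be the total least squares solution, $r=b-Ax$, let $L\in\mathbb{R}^{n\times k}$ ($k\le n$) be fixed, and set $$D_\sigma=L^T\widetilde{M}^{-1}\left(A^T+\frac{2xr^T}{1+\|x\|_2^2}\right).$$ Then the partial mixed and componentwise condition numbers of the total least squares problem with respect to $L$ (defined in the context) are $$\kappa_{mTLS}(A,b)=\frac{\left\|\left|\left[\left(r^T\otimes(L^T\widetilde{M}^{-1})\right)\Pi_{mn}-x^T\otimes D_\sigma,\ D_\sigma\right]\right|\,|\mathrm{vec}(A,b)|\right\|_\infty}{\|L^Tx(A,b)\|_\infty}$$ and $$\kappa_{cTLS}(A,b)=\left\|\frac{\left|\left[\left(r^T\otimes(L^T\widetilde{M}^{-1})\right)\Pi_{mn}-x^T\otimes D_\sigma,\ D_\sigma\right]\right|\,|\mathrm{vec}(A,b)|}{|L^Tx(A,b)|}\right\|_\infty .$$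
   Context: The total least squares (TLS) problem is $\min_{E,\epsilon}\|[E,\epsilon]\|_F$ subject to $(A+E)x=b+\epsilon$; when $\widetilde{\sigma}_{n+1}<\sigma_n$ its unique solution is $x(A,b)=(A^TA-\widetilde{\sigma}_{n+1}^2I_n)^{-1}A^Tb$. Here $\widetilde{\sigma}_{n+1}$ depends on $(A,b)$; $\widetilde{\sigma}_{n+1}^2$ is the smallest eigenvalue of $[A,b]^T[A,b]$. Notation: for $c\in\mathbb{R}$, $c^{\ddag}=1/c$ if $c\neq 0$ and $c^{\ddag}=1$ if $c=0$. For a vector $v$, $\mathrm{diag}^{\ddag}(v)$ is the diagonal matrix with diagonal entries $v_i^{\ddag}$. All divisions between vectors (including scalars) are entry-wise with the convention $\frac{a}{v}=\mathrm{diag}^{\ddag}(v)a$, and similarly for matrices of equal size. $|\cdot|$ applied to a matrix or vector is the entry-wise absolute value. $\|\cdot\|_\infty$ is the max norm of a vector. $\mathrm{vec}$ stacks the columns of a matrix; $\mathrm{vec}(A,b)$ is $\mathrm{vec}(A)$ stacked on top of $b$ (same convention for other pairs). $\otimes$ is the Kronecker product; $\Pi_{mn}$ is the vec-permutation matrix with $\Pi_{mn}\mathrm{vec}(X)=\mathrm{vec}(X^T)$ for all $X\in\mathbb{R}^{m\times n}$. Let $g(A,b)=L^Tx(A,b)$ with $x(A,b)$ the TLS solution, and let $g'(A,b)$ be its Fréchet derivative. For $\xi\in\mathbb{R}^k$ put $$\kappa(\xi)=\sup_{\left\|\mathrm{vec}\left(\frac{\Delta A}{A},\frac{\Delta b}{b}\right)\right\|_\infty\neq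 0}\frac{\left\|\frac{g'(A,b)\circ(\Delta A,\Delta b)}{\xi}\right\|_\infty}{\left\|\mathrm{vec}\left(\frac{\Delta A}{A},\frac{\Delta b}{b}\right)\right\|_\infty},$$ the supremum being over $\Delta A\in\mathbb{R}^{m\times n}$, $\Delta b\in\mathbb{R}^m$, with the requirement that if some entry of $A$ or $b$ is zero, the corresponding entry of $\Delta A$ or $\Delta b$ is zero. The partial mixed condition number is $\kappa_{mTLS}(A,b)=\kappa(\xi)$ with $\xi=[\|L^Tx(A,b)\|_\infty,\dots,\|L^Tx(A,b)\|_\infty]^T$, and the partial componentwise condition number is $\kappa_{cTLS}(A,b)=\kappa(\xi)$ with $\xi=L^Tx(A,b)$. *)

theory Defs
  imports "HOL-Analysis.Analysis"
begin

section \<open>Block matrices, vectorisation and the Kronecker product\<close>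

text \<open>
  Rows and columns are indexed by finite types.  Block indices are sum types and the indices of
  vectorisations and Kronecker products are product types, with the first component as
  the major (block) index.  A type of the form \<^typ>\<open>real ^ 'n ^ 'm\<close> is that of the matrices
  with rows indexed by \<open>'m\<close> and columns indexed by \<open>'n\<close>.
\<close>

definition hcat :: "real ^ 'a ^ 'm \<Rightarrow> real ^ 'b ^ 'm \<Rightarrow> real ^ ('a + 'b) ^ 'm"
  where "hcat M N = (\<chi> i j. case j of Inl p \<Rightarrow> M $ i $ p | Inr q \<Rightarrow> N $ i $ q)"

definition vcat :: "real ^ 'a \<Rightarrow> real ^ 'b \<Rightarrow> real ^ ('a + 'b)"
  where "vcat u v = (\<chi> i. case i of Inl p \<Rightarrow> u $ p | Inr q \<Rightarrow> v $ q)"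

definition augment :: "real ^ 'n ^ 'm \<Rightarrow> real ^ 'm \<Rightarrow> real ^ ('n + 1) ^ 'm"
  where "augment A b = hcat A (columnvector b)"

text \<open>Column stacking: the column index is the block index.\<close>

definition vec_of_mat :: "real ^ 'n ^ 'm \<Rightarrow> real ^ ('n \<times> 'm)"
  where "vec_of_mat X = (\<chi> p. X $ snd p $ fst p)"

definition vec_of_pair :: "real ^ 'n ^ 'm \<Rightarrow> real ^ 'm \<Rightarrow> real ^ (('n \<times> 'm) + 'm)"
  where "vec_of_pair A b = vcat (vec_of_mat A) b"

definition kronecker :: "real ^ 'b ^ 'a \<Rightarrow> real ^ 'd ^ 'c \<Rightarrow> real ^ ('b \<times> 'd) ^ ('a \<times> 'c)"
  where "kronecker B C = (\<chi> i j. B $ fst i $ fst j * C $ snd i $ snd j)"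

text \<open>The product \<open>v\<^sup>T \<otimes> C\<close>, whose row index type \<open>1 \<times> 'c\<close> is identified with \<open>'c\<close>.\<close>

definition row_kronecker :: "real ^ 'b \<Rightarrow> real ^ 'd ^ 'c \<Rightarrow> real ^ ('b \<times> 'd) ^ 'c"
  where "row_kronecker v C = (\<chi> i. kronecker (rowvector v :: real ^ 'b ^ 1) C $ (1, i))"

definition vec_perm :: "real ^ ('n::finite \<times> 'm::finite) ^ ('m \<times> 'n)"
  where "vec_perm = (\<chi> p q. if q = prod.swap p then 1 else 0)"

lemma vec_perm_mult: "vec_perm *v vec_of_mat X = vec_of_mat (transpose X)"
  by (simp add: vec_eq_iff matrix_vector_mult_def vec_perm_def vec_of_mat_def transpose_def
      if_distrib [of "\<lambda>c. c * _"] cong: if_cong)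


section \<open>Entrywise division\<close>

definition ddag :: "real \<Rightarrow> real"
  where "ddag c = (if c = 0 then 1 else 1 / c)"

definition diag_ddag :: "real ^ 'k \<Rightarrow> real ^ 'k ^ 'k"
  where "diag_ddag v = (\<chi> i j. if i = j then ddag (v $ i) else 0)"

definition scal_div :: "real \<Rightarrow> real \<Rightarrow> real"
  where "scal_div a c = ddag c * a"

definition vec_div :: "real ^ 'k \<Rightarrow> real ^ 'k \<Rightarrow> real ^ 'k"
  where "vec_div a v = diag_ddag v *v a"

definition mat_div :: "real ^ 'n ^ 'm \<Rightarrow> real ^ 'n ^ 'm \<Rightarrow> real ^ 'n ^ 'm"
  where "mat_div E A = (\<chi> i j. ddag (A $ i $ j) * E $ i $ j)"


section \<open>Smallest singular value\<close>

definition eigenvalue :: "real ^ 'n ^ 'n \<Rightarrow> real \<Rightarrow> bool"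
  where "eigenvalue M c \<longleftrightarrow> (\<exists>v. v \<noteq> 0 \<and> M *v v = c *\<^sub>R v)"

text \<open>
  There is one singular value per column, counted with multiplicity.  In particular, for a matrix
  with more columns than rows (such as \<open>[A, b]\<close> for a square \<open>A\<close>), 0 is a singular value.
\<close>

definition singular_values :: "real ^ 'n ^ 'm \<Rightarrow> real set"
  where "singular_values M = {sqrt c |c. eigenvalue (transpose M ** M) c}"

definition min_singular_value :: "real ^ 'n ^ 'm \<Rightarrow> real"
  where "min_singular_value M = Min (singular_values M)"


section \<open>The total least squares problem and its condition numbers\<close>

text \<open>On matrix types \<^const>\<open>norm\<close> is the Frobenius norm.\<close>

definition is_tls_solution :: "real ^ 'n ^ 'm \<Rightarrow> real ^ 'm \<Rightarrow> real ^ 'n \<Rightarrow> bool"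
  where "is_tls_solution A b x \<longleftrightarrow>
    (\<exists>E e. (A + E) *v x = b + e \<and>
      (\<forall>E' e' x'. (A + E') *v x' = b + e' \<longrightarrow> norm (augment E e) \<le> norm (augment E' e')))"

definition tls_solution :: "real ^ 'n ^ 'm \<Rightarrow> real ^ 'm \<Rightarrow> real ^ 'n"
  where "tls_solution A b = (THE x. is_tls_solution A b x)"

definition tls_map :: "real ^ 'k ^ 'n \<Rightarrow> (real ^ 'n ^ 'm) \<times> (real ^ 'm) \<Rightarrow> real ^ 'k"
  where "tls_map L = (\<lambda>(A, b). transpose L *v tls_solution A b)"

definition admissible_perturbations ::
    "real ^ 'n ^ 'm \<Rightarrow> real ^ 'm \<Rightarrow> ((real ^ 'n ^ 'm) \<times> (real ^ 'm)) set"
  where "admissible_perturbations A b =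
    {(\<Delta>A, \<Delta>b). (\<forall>i j. A $ i $ j = 0 \<longrightarrow> \<Delta>A $ i $ j = 0) \<and> (\<forall>i. b $ i = 0 \<longrightarrow> \<Delta>b $ i = 0) \<and>
      infnorm (vec_of_pair (mat_div \<Delta>A A) (vec_div \<Delta>b b)) \<noteq> 0}"

text \<open>
  The real supremum is meaningful whenever \<^term>\<open>tls_map L\<close> is differentiable at \<open>(A, b)\<close> and
  \<open>(A, b) \<noteq> 0\<close>: the set of quotients is then nonempty and bounded.
\<close>

definition kappa :: "real ^ 'k ^ 'n \<Rightarrow> real ^ 'n ^ 'm \<Rightarrow> real ^ 'm \<Rightarrow> real ^ 'k \<Rightarrow> real"
  where "kappa L A b \<xi> =
    (SUP (\<Delta>A, \<Delta>b) \<in> admissible_perturbations A b.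
      infnorm (vec_div (frechet_derivative (tls_map L) (at (A, b)) (\<Delta>A, \<Delta>b)) \<xi>) /
      infnorm (vec_of_pair (mat_div \<Delta>A A) (vec_div \<Delta>b b)))"

definition kappa_mTLS :: "real ^ 'k ^ 'n \<Rightarrow> real ^ 'n ^ 'm \<Rightarrow> real ^ 'm \<Rightarrow> real"
  where "kappa_mTLS L A b = kappa L A b (\<chi> i. infnorm (transpose L *v tls_solution A b))"

definition kappa_cTLS :: "real ^ 'k ^ 'n \<Rightarrow> real ^ 'n ^ 'm \<Rightarrow> real ^ 'm \<Rightarrow> real"
  where "kappa_cTLS L A b = kappa L A b (transpose L *v tls_solution A b)"

end

theory Submission
  imports Defs
begin

text \<open>
  Eliminating the perturbation turns total least squares into minimising
  \<open>\<phi>(x) = \<parallel>A x - b\<parallel>\<^sup>2 / (1 + \<parallel>x\<parallel>\<^sup>2)\<close>, whose minimum is the squared smallest singular value of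
  \<open>[A, b]\<close>.  At a minimiser \<open>A\<^sup>T (A x - b) = \<phi>(x) x\<close>, and the gap between the singular values makes
  \<open>\<phi>\<close> grow quadratically away from \<open>x\<close>; hence the minimiser is unique and depends continuously on
  \<open>(A, b)\<close>.  The gap is an open condition because the smallest singular value is 1-Lipschitz.
  Differentiating the stationarity equation implicitly gives the derivative of the solution: since
  \<open>\<phi>\<close> is stationary at \<open>x\<close>, the partial derivative of the equation in \<open>x\<close> is the invertible matrix
  \<open>A\<^sup>T A - \<phi>(x) I\<close>, so no differentiability of singular values is needed.  The condition numbers are
  then weighted maximum row sums of the Jacobian, attained by perturbations whose signs match one of
  its rows.
\<close>


section \<open>Block matrices and the Frobenius norm\<close>

text \<open>Cauchy-Schwarz in every row. The Frobenius norm is the norm of the matrix type, so this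
  is the estimate behind all perturbation bounds below.\<close>

lemma frobenius_bound:
  fixes M :: "real ^ 'n ^ 'm"
  shows "norm (M *v v) \<le> norm M * norm v"
proof -
  have "norm (M *v v) \<le> L2_set (\<lambda>i. norm v * norm (M $ i)) UNIV"
    unfolding norm_vec_def [of "M *v v"]
    by (rule L2_set_mono) (simp_all add: matrix_vector_mul_component Cauchy_Schwarz_ineq2 mult.commute [of "norm v"])
  also have "\<dots> = norm M * norm v"
    by (simp add: L2_set_right_distrib [symmetric] norm_vec_def [of M] mult.commute)
  finally show ?thesis .
qed

text \<open>Supplies the product rule for differentiating matrix-vector products in both
  factors.\<close>

lemma bounded_bilinear_matrix_vector_mult:
  "bounded_bilinear ((*v) :: real ^ 'n ^ 'm \<Rightarrow> real ^ 'n \<Rightarrow> real ^ 'm)"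
proof (rule bounded_bilinear.intro)
  show "\<exists>K. \<forall>(M :: real ^ 'n ^ 'm) v. norm (M *v v) \<le> norm M * norm v * K"
    by (rule exI [of _ 1]) (simp add: frobenius_bound)
qed (simp_all add: matrix_vector_mult_add_rdistrib matrix_vector_right_distrib
       scaleR_matrix_vector_assoc matrix_vector_mult_scaleR)

lemma bounded_linear_transpose:
  "bounded_linear (transpose :: real ^ 'n ^ 'm \<Rightarrow> real ^ 'm ^ 'n)"
  by (simp add: linear_conv_bounded_linear [symmetric] linear_iff transpose_def vec_eq_iff)

lemma sum_UNIV_Plus:
  "(\<Sum>p\<in>(UNIV :: ('a::finite + 'b::finite) set). f p) = (\<Sum>i\<in>UNIV. f (Inl i)) + (\<Sum>j\<in>UNIV. f (Inr j))"
  by (simp add: UNIV_Plus_UNIV [symmetric] sum.Plus del: UNIV_Plus_UNIV)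

lemma norm_vcat: "(norm (vcat u v))\<^sup>2 = (norm u)\<^sup>2 + (norm v)\<^sup>2"
  by (simp add: power2_norm_eq_inner inner_vec_def vcat_def sum_UNIV_Plus)

lemma augment_mult_vcat: "augment A b *v vcat u w = A *v u + w $ 1 *\<^sub>R b"
  by (simp add: vec_eq_iff matrix_vector_mult_def augment_def hcat_def vcat_def sum_UNIV_Plus
      columnvector_def)

lemma vcat_cases: obtains u v where "w = vcat u v"
proof
  show "w = vcat (\<chi> i. w $ Inl i) (\<chi> j. w $ Inr j)"
    by (simp add: vec_eq_iff vcat_def split: sum.split)
qed

lemma norm_augment: "(norm (augment A b))\<^sup>2 = (norm A)\<^sup>2 + (norm b)\<^sup>2"
  by (simp add: power2_norm_eq_inner inner_vec_def augment_def hcat_def sum_UNIV_Plus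
      columnvector_def sum.distrib)

lemma bounded_linear_augment:
  "bounded_linear (\<lambda>p :: (real ^ 'n ^ 'm) \<times> (real ^ 'm). augment (fst p) (snd p))"
  by (simp add: linear_conv_bounded_linear [symmetric] linear_iff augment_def hcat_def
      columnvector_def vec_eq_iff split: sum.split)


section \<open>The smallest singular value\<close>

text \<open>A quadratic that vanishes at 0 and is nonnegative has a minimum there. Both variational
  arguments below, for the Rayleigh quotient and for the TLS objective, end in this form.\<close>

lemma linear_coeff_zero_of_nonneg_quadratic:
  fixes \<alpha> \<beta> :: real
  assumes "\<And>s. 0 \<le> s * \<beta> + s\<^sup>2 * \<alpha>"
  shows "\<beta> = 0"
proof (rule ccontr)
  assume "\<beta> \<noteq> 0"
  \<comment> \<open>Since \<open>k\<close> is positive and exceeds \<open>\<alpha>\<close>, the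
    point \<open>- \<beta> / k\<close> makes the quadratic negative.\<close>
  define k where "k = \<bar>\<alpha>\<bar> + 1"
  have k: "k > 0" "\<alpha> < k" by (auto simp: k_def)
  have "0 \<le> (- \<beta> / k) * \<beta> + (- \<beta> / k)\<^sup>2 * \<alpha>" by (rule assms)
  also have "\<dots> = (\<beta> / k)\<^sup>2 * (\<alpha> - k)"
    using k by (simp add: field_simps power2_eq_square)
  also have "\<dots> < 0" using k \<open>\<beta> \<noteq> 0\<close> by (intro mult_pos_neg) auto
  finally show False by simp
qed

lemma norm_add_scaleR_power2:
  "(norm (a + s *\<^sub>R u))\<^sup>2 = (norm a)\<^sup>2 + 2 * s * (a \<bullet> u) + s\<^sup>2 * (norm u)\<^sup>2"
  unfolding power2_norm_eq_inner
  by (simp only: inner_add_left inner_add_right inner_scaleR_left inner_scaleR_right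
      inner_commute [of u a]) (simp add: algebra_simps power2_eq_square)

text \<open>Eigenvectors of distinct eigenvalues are orthogonal, hence independent, so the dimension
  bounds their number. Finiteness makes the \<open>Min\<close> in \<open>min_singular_value\<close>
  meaningful.\<close>

lemma finite_eigenvalues_symmetric:
  fixes M :: "real ^ 'n ^ 'n"
  assumes "transpose M = M"
  shows "finite {c. eigenvalue M c}"
proof -
  define v where "v c = (SOME v. v \<noteq> 0 \<and> M *v v = c *\<^sub>R v)" for c
  have v: "v c \<noteq> 0" "M *v v c = c *\<^sub>R v c" if "eigenvalue M c" for c
    using someI_ex [of "\<lambda>v. v \<noteq> 0 \<and> M *v v = c *\<^sub>R v"] that by (auto simp: v_def eigenvalue_def)
  have orth: "v c \<bullet> v d = 0" if "eigenvalue M c" "eigenvalue M d" "c \<noteq> d" for c d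
  proof -
    have "c * (v c \<bullet> v d) = (M *v v c) \<bullet> v d" using v that by simp
    also have "\<dots> = v c \<bullet> (M *v v d)" by (metis assms dot_lmul_matrix vector_transpose_matrix)
    also have "\<dots> = d * (v c \<bullet> v d)" using v that by simp
    finally show ?thesis using that by simp
  qed
  have inj: "inj_on v {c. eigenvalue M c}"
    using orth v by (intro inj_onI) (metis inner_eq_zero_iff mem_Collect_eq)
  have "independent (v ` {c. eigenvalue M c})"
    using orth v by (intro pairwise_orthogonal_independent) (auto simp: pairwise_def orthogonal_def)
  then show ?thesis using inj by (metis finite_image_iff independent_bound)
qed

text \<open>Translates the spectral definition into the variational one: a minimiser of
  \<open>norm (M *v v)\<close> on the compact unit sphere is an eigenvector of
  \<open>transpose M ** M\<close>, and its eigenvalue is the smallest one.\<close>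

lemma min_singular_value_Rayleigh:
  fixes M :: "real ^ 'n ^ 'm"
  shows min_singular_value_nonneg: "0 \<le> min_singular_value M"
    and min_singular_value_le: "min_singular_value M * norm v \<le> norm (M *v v)"
    and min_singular_value_attained:
      "\<exists>w. norm w = 1 \<and> norm (M *v w) = min_singular_value M"
proof -
  let ?N = "transpose M ** M"
  have N: "(?N *v u) \<bullet> w = (M *v u) \<bullet> (M *v w)" for u w
    by (metis dot_lmul_matrix matrix_vector_mul_assoc transpose_transpose vector_transpose_matrix)
  have "continuous_on (sphere 0 1) (\<lambda>v. norm (M *v v))"
    by (intro continuous_intros)
  moreover have "sphere (0 :: real ^ 'n) 1 \<noteq> {}" by simp
  ultimately obtain w where w: "norm w = 1"
    and min: "\<And>v. norm v = 1 \<Longrightarrow> norm (M *v w) \<le> norm (M *v v)"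
    using continuous_attains_inf [of "sphere (0 :: real ^ 'n) 1" "\<lambda>v. norm (M *v v)"] by auto
  define c where "c = (norm (M *v w))\<^sup>2"
  have le: "norm (M *v w) * norm v \<le> norm (M *v v)" for v
  proof (cases "v = 0")
    case False
    then show ?thesis
      using min [of "v /\<^sub>R norm v"] by (simp add: matrix_vector_mult_scaleR field_simps)
  qed simp
  have le2: "c * (norm v)\<^sup>2 \<le> (norm (M *v v))\<^sup>2" for v
    using power_mono [OF le [of v], of 2] by (simp add: c_def power_mult_distrib)
  have "(?N *v w - c *\<^sub>R w) \<bullet> u = 0" for u
  proof -
    have "2 * ((?N *v w - c *\<^sub>R w) \<bullet> u) = 0"
    \<comment> \<open>Varying \<open>w\<close> in the direction \<open>u\<close> gives a nonnegative
      quadratic in \<open>s\<close>; its constant term vanishes because \<open>c\<close> is the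
      value at the unit vector \<open>w\<close>.\<close>
    proof (rule linear_coeff_zero_of_nonneg_quadratic)
      fix s
      have "0 \<le> (norm (M *v (w + s *\<^sub>R u)))\<^sup>2 - c * (norm (w + s *\<^sub>R u))\<^sup>2"
        using le2 by simp
      also have "\<dots> = s * (2 * ((?N *v w - c *\<^sub>R w) \<bullet> u))
          + s\<^sup>2 * ((norm (M *v u))\<^sup>2 - c * (norm u)\<^sup>2)"
        using w by (simp add: matrix_vector_right_distrib matrix_vector_mult_scaleR
            norm_add_scaleR_power2 inner_diff_left N algebra_simps flip: c_def)
      finally show "0 \<le> s * (2 * ((?N *v w - c *\<^sub>R w) \<bullet> u))
          + s\<^sup>2 * ((norm (M *v u))\<^sup>2 - c * (norm u)\<^sup>2)" .
    qed
    then show ?thesis by simp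
  qed
  then have "?N *v w = c *\<^sub>R w"
    by (metis inner_eq_zero_iff right_minus_eq)
  then have ev: "eigenvalue ?N c" using w unfolding eigenvalue_def by (metis norm_zero zero_neq_one)
  have ge: "c \<le> d" if d: "eigenvalue ?N d" for d
  proof -
    obtain v where v: "v \<noteq> 0" "?N *v v = d *\<^sub>R v" using d by (auto simp: eigenvalue_def)
    then have "d * (norm v)\<^sup>2 = (norm (M *v v))\<^sup>2"
      using N [of v v] by (simp add: power2_norm_eq_inner)
    with le2 [of v] v show ?thesis by (metis mult_right_le_imp_le zero_less_norm_iff zero_less_power)
  qed
  have fin: "finite (singular_values M)"
  proof -
    have "singular_values M = sqrt ` {c. eigenvalue ?N c}"
      by (auto simp: singular_values_def)
    then show ?thesis
      by (simp add: finite_eigenvalues_symmetric matrix_transpose_mul)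
  qed
  have "min_singular_value M = sqrt c"
    unfolding min_singular_value_def
    by (rule Min_eqI) (use fin ev ge in \<open>auto simp: singular_values_def\<close>)
  then have eq: "min_singular_value M = norm (M *v w)" by (simp add: c_def)
  show "0 \<le> min_singular_value M" by (simp add: eq)
  show "min_singular_value M * norm v \<le> norm (M *v v)" by (simp add: eq le)
  show "\<exists>w. norm w = 1 \<and> norm (M *v w) = min_singular_value M" using w eq by auto
qed

text \<open>Test \<open>M\<close> on the unit vector that is optimal for \<open>N\<close>.\<close>

lemma min_singular_value_le_add: "min_singular_value M \<le> min_singular_value N + norm (M - N)"
proof -
  obtain w where w: "norm w = 1" "norm (N *v w) = min_singular_value N"
    using min_singular_value_attained by blast
  have "min_singular_value M \<le> norm (M *v w)"
    using min_singular_value_le [of M w] w by simp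
  also have "\<dots> = norm (N *v w + (M - N) *v w)" by (simp add: matrix_vector_mult_diff_rdistrib)
  also have "\<dots> \<le> norm (N *v w) + norm (M - N)"
    using norm_triangle_ineq [of "N *v w" "(M - N) *v w"] frobenius_bound [of "M - N" w] w by simp
  finally show ?thesis using w by simp
qed

lemma isCont_min_singular_value: "isCont min_singular_value M"
proof -
  have "norm (min_singular_value N - min_singular_value M) \<le> norm (N - M)" for N
    using min_singular_value_le_add [of N M] min_singular_value_le_add [of M N]
    by (simp add: norm_minus_commute abs_le_iff)
  then have "\<forall>\<^sub>F N in at M. norm (min_singular_value N - min_singular_value M) \<le> norm (N - M)"
    by (rule always_eventually [OF allI])
  moreover have "((\<lambda>N. norm (N - M)) \<longlongrightarrow> 0) (at M)"
    by (rule tendsto_norm_zero [OF LIM_zero [OF tendsto_ident_at]])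
  ultimately have "((\<lambda>N. min_singular_value N - min_singular_value M) \<longlongrightarrow> 0) (at M)"
    by (rule Lim_null_comparison)
  then show ?thesis by (simp add: isCont_def LIM_zero_iff)
qed


section \<open>Implicit differentiation\<close>

text \<open>The branch \<open>g\<close> is given and known to be continuous, so differentiability of
  \<open>F\<close> at one point and a left inverse \<open>T\<close> of its partial derivative in the
  second variable suffice.\<close>

lemma has_derivative_implicit_function:
  fixes F :: "'a::real_normed_vector \<times> 'b::real_normed_vector \<Rightarrow> 'c::real_normed_vector"
  assumes F: "(F has_derivative F') (at (p, g p))"
    and T: "bounded_linear T" "\<And>h. T (F' (0, h)) = h"
    and g: "isCont g p"
    and zero: "\<forall>\<^sub>F q in nhds p. F (q, g q) = 0"
  shows "(g has_derivative (\<lambda>h. - T (F' (h, 0)))) (at p)"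
proof -
  interpret F': bounded_linear F' using F by (rule has_derivative_bounded_linear)
  interpret T: bounded_linear T by (rule T)
  let ?g = "\<lambda>h. - T (F' (h, 0))"
  have "bounded_linear (\<lambda>h. T (F' (h, 0)))"
    by (intro bounded_linear_compose [OF T(1)] bounded_linear_compose [OF F'.bounded_linear_axioms]
        bounded_linear_Pair bounded_linear_ident bounded_linear_zero)
  then have bl: "bounded_linear ?g" by (rule bounded_linear_minus)
  obtain S where S: "S > 0" "\<And>h. norm (?g h) \<le> norm h * S"
    using bounded_linear.pos_bounded [OF bl] by blast
  obtain K where K: "K > 0" "\<And>h. norm (T h) \<le> norm h * K"
    using T.pos_bounded by blast
  show ?thesis
    unfolding has_derivative_within_alt2
  proof (intro conjI bl allI impI)
    fix e :: real assume e: "e > 0"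
    \<comment> \<open>The first bound lets half of \<open>norm (g q - g p)\<close> be absorbed; the
      second turns the constant that remains into \<open>e\<close>.\<close>
    define d where "d = min (1 / (2 * K)) (e / (K * (2 * S + 2)))"
    have d: "d > 0" "K * d \<le> 1 / 2" "K * d * (2 * S + 2) \<le> e"
    proof -
      show "d > 0" using e K S by (simp add: d_def)
      have "K * d \<le> K * (1 / (2 * K))" using K by (intro mult_left_mono) (auto simp: d_def)
      then show "K * d \<le> 1 / 2" using K by simp
      have "K * d * (2 * S + 2) \<le> K * (e / (K * (2 * S + 2))) * (2 * S + 2)"
        using K S by (intro mult_right_mono mult_left_mono) (auto simp: d_def)
      also have "\<dots> = e" using K S by (simp add: field_simps add_nonneg_eq_0_iff)
      finally show "K * d * (2 * S + 2) \<le> e" .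
    qed
    have cont: "((\<lambda>q. (q, g q)) \<longlongrightarrow> (p, g p)) (at p)"
      using g by (intro tendsto_Pair) (auto simp: isCont_def)
    have "\<forall>\<^sub>F z in nhds (p, g p).
        norm (F z - F (p, g p) - F' (z - (p, g p))) \<le> d * norm (z - (p, g p))"
      using F d(1) unfolding has_derivative_within_alt2 eventually_at_filter
      by (auto elim!: allE [of _ d] elim: eventually_mono simp: F'.zero)
    then have near: "\<forall>\<^sub>F q in at p. norm (F (q, g q) - F (p, g p) - F' ((q, g q) - (p, g p)))
        \<le> d * norm ((q, g q) - (p, g p))"
      by (rule eventually_compose_filterlim [OF _ cont])
    have zp: "F (p, g p) = 0" using zero eventually_nhds_x_imp_x by blast
    show "\<forall>\<^sub>F q in at p. norm (g q - g p - ?g (q - p)) \<le> e * norm (q - p)"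
      using near eventually_nhds_conv_at [THEN iffD1, OF zero, THEN conjunct1]
    proof eventually_elim
      case (elim q)
      let ?u = "q - p" and ?v = "g q - g p"
      \<comment> \<open>As \<open>T\<close> inverts the partial derivative, the error is
        \<open>T\<close> applied to the full linearisation, which is small because \<open>F\<close>
        vanishes along the graph of \<open>g\<close>.\<close>
      have "?v - ?g ?u = T (F' (?u, 0)) + T (F' (0, ?v))" by (simp add: T(2))
      also have "\<dots> = T (F' (?u, ?v))" by (simp add: T.add [symmetric] F'.add [symmetric])
      finally have eq: "?v - ?g ?u = T (F' (?u, ?v))" .
      have "norm (F' (?u, ?v)) \<le> d * norm (?u, ?v)" using elim zp by simp
      also have "\<dots> \<le> d * (norm ?u + norm ?v)"
        using d by (simp add: norm_Pair_le mult_left_mono)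
      finally have "norm (F' (?u, ?v)) * K \<le> d * (norm ?u + norm ?v) * K"
        using K by (simp add: mult_right_mono)
      with K(2) [of "F' (?u, ?v)"] eq
      have est: "norm (?v - ?g ?u) \<le> K * d * (norm ?u + norm ?v)"
        by (simp add: mult.commute mult.left_commute)
      \<comment> \<open>Absorbing half of \<open>norm ?v\<close> on the left gives a Lipschitz bound
        for \<open>g\<close> at \<open>p\<close>, after which the error is controlled by
        \<open>norm ?u\<close> alone.\<close>
      have "K * d * (norm ?u + norm ?v) \<le> 1 / 2 * (norm ?u + norm ?v)"
        using d by (intro mult_right_mono) auto
      moreover have "norm ?v \<le> norm (?v - ?g ?u) + norm (?g ?u)"
        by (metis diff_add_cancel norm_triangle_ineq)
      ultimately have "norm ?v \<le> (2 * S + 1) * norm ?u"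
        using est S(2) [of ?u] by (simp add: algebra_simps)
      then have "K * d * (norm ?u + norm ?v) \<le> K * d * ((2 * S + 2) * norm ?u)"
        using K d by (intro mult_left_mono) (auto simp: algebra_simps)
      also have "\<dots> \<le> e * norm ?u"
        using mult_right_mono [OF d(3), of "norm ?u"] by (simp add: mult.assoc)
      finally show ?case using est by simp
    qed
  qed
qed


section \<open>The total least squares solution\<close>

text \<open>This is the Rayleigh quotient of \<open>transpose (augment A b) ** augment A b\<close>
  at the lifted vector \<open>vcat x (- 1)\<close>.\<close>

definition tls_objective :: "real ^ 'n ^ 'm \<Rightarrow> real ^ 'm \<Rightarrow> real ^ 'n \<Rightarrow> real"
  where "tls_objective A b x = (norm (A *v x - b))\<^sup>2 / (1 + (norm x)\<^sup>2)"

lemma one_plus_norm_pos: "1 + (norm x)\<^sup>2 > 0"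
  by (simp add: add_pos_nonneg)

lemma tls_objective_mult:
  "tls_objective A b x * (1 + (norm x)\<^sup>2) = (norm (A *v x - b))\<^sup>2"
  using one_plus_norm_pos [of x] by (simp add: tls_objective_def)

lemma augment_mult_lift: "augment A b *v vcat x (- 1) = A *v x - b"
  by (simp add: augment_mult_vcat)

lemma norm_lift: "(norm (vcat x (- 1 :: real ^ 1)))\<^sup>2 = 1 + (norm x)\<^sup>2"
proof -
  have "norm (- 1 :: real ^ 1) = 1" by (simp add: norm_vec_def L2_set_def)
  then show ?thesis by (simp add: norm_vcat)
qed

text \<open>Consistency says that the perturbed augmented matrix annihilates
  \<open>vcat x (- 1)\<close>, so \<open>augment E e\<close> must map this vector to minus the
  residual.\<close>

lemma tls_objective_le_perturbation:
  assumes "(A + E) *v x = b + e"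
  shows "tls_objective A b x \<le> (norm (augment E e))\<^sup>2"
proof -
  have "A *v x - b = - (augment E e *v vcat x (- 1))"
    using assms by (simp add: augment_mult_lift matrix_vector_mult_add_rdistrib algebra_simps)
  then have "norm (A *v x - b) \<le> norm (augment E e) * norm (vcat x (- 1 :: real ^ 1))"
    using frobenius_bound by (metis norm_minus_cancel)
  from power_mono [OF this norm_ge_zero, of 2] show ?thesis
    using one_plus_norm_pos [of x]
    by (simp add: tls_objective_def power_mult_distrib norm_lift pos_divide_le_eq)
qed

lemma tls_objective_attained:
  fixes A :: "real ^ 'n ^ 'm"
  shows "\<exists>E e. (A + E) *v x = b + e \<and> (norm (augment E e))\<^sup>2 = tls_objective A b x"
proof (intro exI conjI)
  define w where "w = 1 + (norm x)\<^sup>2"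
  have w: "w > 0" unfolding w_def by (rule one_plus_norm_pos)
  define s where "s = A *v x - b"
  \<comment> \<open>With \<open>e = s / w\<close> this makes \<open>augment E e\<close> the rank-one
    matrix of entries \<open>- s $ i / w\<close> times those of \<open>vcat x (- 1)\<close>, the
    equality case of the Frobenius bound.\<close>
  define E :: "real ^ 'n ^ 'm" where "E = (\<chi> i. - (s $ i / w) *\<^sub>R x)"
  have Ex: "E *v x = - ((norm x)\<^sup>2 / w) *\<^sub>R s"
    by (simp add: E_def vec_eq_iff matrix_vector_mul_component power2_norm_eq_inner)
  have "(norm x)\<^sup>2 / w + 1 / w = 1" using w by (simp add: w_def field_simps)
  then have "((norm x)\<^sup>2 / w) *\<^sub>R s + (1 / w) *\<^sub>R s = s" by (simp flip: scaleR_add_left)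
  then have "A *v x - b = ((norm x)\<^sup>2 / w) *\<^sub>R s + (1 / w) *\<^sub>R s" by (simp add: s_def)
  then show "(A + E) *v x = b + (1 / w) *\<^sub>R s"
    by (simp add: matrix_vector_mult_add_rdistrib Ex diff_eq_eq)
  have "(norm E)\<^sup>2 = (\<Sum>i\<in>UNIV. (norm (E $ i))\<^sup>2)"
    by (simp only: power2_norm_eq_inner inner_vec_def [of E E])
  also have "\<dots> = (\<Sum>i\<in>UNIV. (s $ i)\<^sup>2) / w\<^sup>2 * (norm x)\<^sup>2"
    by (simp add: E_def power_mult_distrib power_divide sum_divide_distrib sum_distrib_right)
  also have "(\<Sum>i\<in>UNIV. (s $ i)\<^sup>2) = (norm s)\<^sup>2"
    by (simp add: power2_norm_eq_inner inner_vec_def power2_eq_square [symmetric])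
  finally have "(norm E)\<^sup>2 = (norm s)\<^sup>2 / w\<^sup>2 * (norm x)\<^sup>2" .
  then have "(norm (augment E ((1 / w) *\<^sub>R s)))\<^sup>2 = (norm s)\<^sup>2 / w\<^sup>2 * w"
    by (simp add: norm_augment power_divide) (simp add: w_def add_divide_distrib algebra_simps)
  also have "\<dots> = tls_objective A b x"
    unfolding tls_objective_def w_def [symmetric] s_def [symmetric]
    using w by (simp add: power2_eq_square)
  finally show "(norm (augment E ((1 / w) *\<^sub>R s)))\<^sup>2 = tls_objective A b x" .
qed

text \<open>For fixed \<open>x\<close>, the least squared norm of a perturbation making
  \<open>x\<close> consistent is the objective, by the two preceding lemmas; only the minimisation
  over \<open>x\<close> remains.\<close>

lemma is_tls_solution_iff:
  "is_tls_solution A b x \<longleftrightarrow> (\<forall>y. tls_objective A b x \<le> tls_objective A b y)"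
proof
  assume "is_tls_solution A b x"
  then obtain E e where E: "(A + E) *v x = b + e"
    and min: "\<And>E' e' x'. (A + E') *v x' = b + e' \<Longrightarrow> norm (augment E e) \<le> norm (augment E' e')"
    unfolding is_tls_solution_def by blast
  show "\<forall>y. tls_objective A b x \<le> tls_objective A b y"
  proof
    fix y
    obtain E' e' where E': "(A + E') *v y = b + e'"
      "(norm (augment E' e'))\<^sup>2 = tls_objective A b y"
      using tls_objective_attained by blast
    with power_mono [OF min [OF E'(1)] norm_ge_zero, of 2] tls_objective_le_perturbation [OF E]
    show "tls_objective A b x \<le> tls_objective A b y" by simp
  qed
next
  assume min: "\<forall>y. tls_objective A b x \<le> tls_objective A b y"
  obtain E e where E: "(A + E) *v x = b + e" "(norm (augment E e))\<^sup>2 = tls_objective A b x"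
    using tls_objective_attained by blast
  show "is_tls_solution A b x"
    unfolding is_tls_solution_def
  proof (intro exI conjI allI impI)
    show "(A + E) *v x = b + e" by (rule E)
    fix E' e' x' assume "(A + E') *v x' = b + e'"
    then have "(norm (augment E e))\<^sup>2 \<le> (norm (augment E' e'))\<^sup>2"
      using tls_objective_le_perturbation E(2) min by (metis order_trans)
    then show "norm (augment E e) \<le> norm (augment E' e')" by simp
  qed
qed

section \<open>Optimality, existence and uniqueness\<close>

lemma transpose_inner: "(transpose M *v u) \<bullet> w = u \<bullet> (M *v (w :: real ^ 'n))"
  by (simp add: dot_lmul_matrix)

text \<open>Clearing the positive denominator turns minimality along a line into nonnegativity of a
  quadratic, so the quotient need not be differentiated.\<close>

lemma tls_stationary:
  assumes min: "\<And>y. tls_objective A b x \<le> tls_objective A b y"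
  shows "transpose A *v (A *v x - b) = tls_objective A b x *\<^sub>R x"
proof -
  let ?c = "tls_objective A b x" and ?s = "A *v x - b"
  have "(transpose A *v ?s - ?c *\<^sub>R x) \<bullet> u = 0" for u
  proof -
    have "2 * ((transpose A *v ?s - ?c *\<^sub>R x) \<bullet> u) = 0"
    proof (rule linear_coeff_zero_of_nonneg_quadratic)
      fix t
      let ?y = "x + t *\<^sub>R u"
      have eq: "A *v ?y - b = ?s + t *\<^sub>R (A *v u)"
        by (simp add: matrix_vector_right_distrib matrix_vector_mult_scaleR)
      have "?c * (1 + (norm ?y)\<^sup>2) \<le> tls_objective A b ?y * (1 + (norm ?y)\<^sup>2)"
        using min [of ?y] one_plus_norm_pos [of ?y] by (intro mult_right_mono) auto
      then have "0 \<le> (norm (?s + t *\<^sub>R (A *v u)))\<^sup>2 - ?c * (1 + (norm ?y)\<^sup>2)"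
        by (simp only: tls_objective_mult eq diff_ge_0_iff_ge)
      also have "\<dots> = t * (2 * ((transpose A *v ?s - ?c *\<^sub>R x) \<bullet> u))
          + t\<^sup>2 * ((norm (A *v u))\<^sup>2 - ?c * (norm u)\<^sup>2)"
        unfolding norm_add_scaleR_power2 tls_objective_mult [of A b x, symmetric]
          inner_diff_left transpose_inner inner_scaleR_left
        by (simp add: algebra_simps)
      finally show "0 \<le> t * (2 * ((transpose A *v ?s - ?c *\<^sub>R x) \<bullet> u))
          + t\<^sup>2 * ((norm (A *v u))\<^sup>2 - ?c * (norm u)\<^sup>2)" .
    qed
    then show ?thesis by simp
  qed
  from this [of "transpose A *v ?s - ?c *\<^sub>R x"] show ?thesis
    by (simp only: inner_eq_zero_iff right_minus_eq)
qed

text \<open>Expanding around \<open>x\<close>, the linear terms cancel by stationarity and an exact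
  identity is left. It drives both uniqueness and continuity.\<close>

lemma tls_growth:
  assumes min: "\<And>y. tls_objective A b x \<le> tls_objective A b y"
  shows "(tls_objective A b y - tls_objective A b x) * (1 + (norm y)\<^sup>2)
    = (norm (A *v (y - x)))\<^sup>2 - tls_objective A b x * (norm (y - x))\<^sup>2"
proof -
  let ?c = "tls_objective A b x" and ?s = "A *v x - b" and ?d = "y - x"
  have eq: "A *v y - b = ?s + 1 *\<^sub>R (A *v ?d)" by (simp add: matrix_vector_mult_diff_distrib)
  have 1: "(norm (A *v y - b))\<^sup>2 = (norm ?s)\<^sup>2 + 2 * (?s \<bullet> (A *v ?d)) + (norm (A *v ?d))\<^sup>2"
    unfolding eq norm_add_scaleR_power2 by simp
  have 2: "(norm y)\<^sup>2 = (norm x)\<^sup>2 + 2 * (x \<bullet> ?d) + (norm ?d)\<^sup>2"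
    using norm_add_scaleR_power2 [of x 1 ?d] by simp
  have 3: "?s \<bullet> (A *v ?d) = ?c * (x \<bullet> ?d)"
    using tls_stationary [OF min] transpose_inner [of A ?s ?d] by simp
  have "(tls_objective A b y - ?c) * (1 + (norm y)\<^sup>2) = (norm (A *v y - b))\<^sup>2 - ?c * (1 + (norm y)\<^sup>2)"
    by (simp add: left_diff_distrib tls_objective_mult)
  also have "\<dots> = (norm (A *v ?d))\<^sup>2 - ?c * (norm ?d)\<^sup>2"
    unfolding 1 2 3 tls_objective_mult [of A b x, symmetric] by (simp add: algebra_simps)
  finally show ?thesis .
qed

lemma min_singular_value_le_power2:
  "(min_singular_value M)\<^sup>2 * (norm v)\<^sup>2 \<le> (norm (M *v v))\<^sup>2"
  unfolding power_mult_distrib [symmetric]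
  by (intro power_mono min_singular_value_le mult_nonneg_nonneg min_singular_value_nonneg norm_ge_zero)

lemma min_singular_value_le_tls_objective:
  "(min_singular_value (augment A b))\<^sup>2 \<le> tls_objective A b y"
  using min_singular_value_le_power2 [of "augment A b" "vcat y (- 1)"]
  unfolding augment_mult_lift norm_lift tls_objective_def pos_le_divide_eq [OF one_plus_norm_pos] .

text \<open>A unit vector attaining the smallest singular value of \<open>augment A b\<close> is
  rescaled to a lift \<open>vcat x (- 1)\<close>, so the lower bound by that singular value is
  attained; growth gives uniqueness, so the \<open>THE\<close> in \<open>tls_solution\<close>
  denotes this \<open>x\<close>.\<close>

lemma tls_solution_minimal:
  assumes gap: "min_singular_value (augment A b) < min_singular_value A"
  shows tls_objective_tls_solution:
      "tls_objective A b (tls_solution A b) = (min_singular_value (augment A b))\<^sup>2"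
    and tls_solution_min: "tls_objective A b (tls_solution A b) \<le> tls_objective A b y"
proof -
  let ?\<tau> = "min_singular_value (augment A b)" and ?\<sigma> = "min_singular_value A"
  obtain w where w: "norm w = 1" "norm (augment A b *v w) = ?\<tau>"
    using min_singular_value_attained by blast
  obtain u v where uv: "w = vcat u v" by (rule vcat_cases)
  define t where "t = v $ 1"
  have nv: "norm v = \<bar>t\<bar>" by (simp add: t_def norm_vec_def)
  have n1: "(norm u)\<^sup>2 + t\<^sup>2 = 1"
    using w(1) norm_vcat [of u v] by (simp add: uv nv)
  have \<tau>: "norm (A *v u + t *\<^sub>R b) = ?\<tau>" using w(2) by (simp add: uv augment_mult_vcat t_def)
  \<comment> \<open>If \<open>t\<close> were 0, the unit vector \<open>u\<close> would show that the
    smallest singular value of \<open>A\<close> is at most that of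
    \<open>augment A b\<close>.\<close>
  have "t \<noteq> 0"
  proof
    assume "t = 0"
    with n1 have "norm u = 1" by (simp add: power2_eq_1_iff) (use norm_ge_zero [of u] in linarith)
    with \<open>t = 0\<close> \<tau> min_singular_value_le [of A u] gap show False by simp
  qed
  define x where "x = - (1 / t) *\<^sub>R u"
  have "A *v x - b = - (1 / t) *\<^sub>R (A *v u + t *\<^sub>R b)"
    using \<open>t \<noteq> 0\<close> by (simp add: x_def scaleR_add_right matrix_vector_mult_scaleR flip: scaleR_minus_left)
  then have "(norm (A *v x - b))\<^sup>2 = ?\<tau>\<^sup>2 / t\<^sup>2"
    by (simp add: \<tau> power_divide)
  moreover have "1 + (norm x)\<^sup>2 = 1 / t\<^sup>2"
    using n1 \<open>t \<noteq> 0\<close> by (simp add: x_def power_divide field_simps)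
  ultimately have val: "tls_objective A b x = ?\<tau>\<^sup>2"
    using \<open>t \<noteq> 0\<close> by (simp add: tls_objective_def)
  have min: "tls_objective A b x \<le> tls_objective A b y" for y
    using val min_singular_value_le_tls_objective by simp
  have "tls_solution A b = x"
    unfolding tls_solution_def
  proof (rule the_equality)
    show "is_tls_solution A b x" using min by (simp add: is_tls_solution_iff)
    fix z assume "is_tls_solution A b z"
    then have "tls_objective A b z = ?\<tau>\<^sup>2"
      using min [of z] val by (metis antisym is_tls_solution_iff)
    \<comment> \<open>Equal objective values kill the left side of \<open>tls_growth\<close>; the
      gap then forces \<open>z - x\<close> to vanish.\<close>
    then have "(norm (A *v (z - x)))\<^sup>2 = ?\<tau>\<^sup>2 * (norm (z - x))\<^sup>2"
      using tls_growth [OF min, of z] val by simp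
    then have "?\<sigma>\<^sup>2 * (norm (z - x))\<^sup>2 \<le> ?\<tau>\<^sup>2 * (norm (z - x))\<^sup>2"
      using min_singular_value_le_power2 [of A "z - x"] by simp
    moreover have "?\<tau>\<^sup>2 < ?\<sigma>\<^sup>2"
      using gap min_singular_value_nonneg [of "augment A b"] by (simp add: power_strict_mono)
    ultimately show "z = x"
      by (metis mult_strict_right_mono not_less right_minus_eq zero_less_norm_iff zero_less_power)
  qed
  then show "tls_objective A b (tls_solution A b) = ?\<tau>\<^sup>2"
    "tls_objective A b (tls_solution A b) \<le> tls_objective A b y"
    using val min by auto
qed

section \<open>Stability under perturbation of the data\<close>

lemma eventually_tls_gap:
  fixes A :: "real ^ 'n ^ 'm"
  assumes "min_singular_value (augment A b) < min_singular_value A"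
  shows "\<forall>\<^sub>F q in nhds (A, b).
    min_singular_value (augment (fst q) (snd q)) < min_singular_value (fst q)"
proof -
  define h where
    "h q = min_singular_value (fst q) - min_singular_value (augment (fst q) (snd q))"
    for q :: "(real ^ 'n ^ 'm) \<times> (real ^ 'm)"
  have "isCont h (A, b)"
    unfolding h_def
    by (intro continuous_diff isCont_o2 [OF _ isCont_min_singular_value] isCont_fst continuous_ident
        linear_continuous_at bounded_linear_augment)
  then have "(h \<longlongrightarrow> h (A, b)) (nhds (A, b))"
    unfolding isCont_def tendsto_at_iff_tendsto_nhds .
  moreover have "0 < h (A, b)" using assms by (simp add: h_def)
  ultimately have "\<forall>\<^sub>F q in nhds (A, b). 0 < h q" by (rule order_tendstoD)
  then show ?thesis by (rule eventually_mono) (simp add: h_def)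
qed

text \<open>Quantitative positive definiteness of the shifted Gram matrix, with the difference of
  the squared singular values as constant. It serves continuity and invertibility alike.\<close>

lemma tls_gap_coercive:
  assumes "min_singular_value (augment A b) < min_singular_value A"
  obtains \<delta> where "\<delta> > 0"
    "\<And>u. \<delta> * (norm u)\<^sup>2 \<le> (norm (A *v u))\<^sup>2 - (min_singular_value (augment A b))\<^sup>2 * (norm u)\<^sup>2"
proof
  show "(min_singular_value A)\<^sup>2 - (min_singular_value (augment A b))\<^sup>2 > 0"
    using assms min_singular_value_nonneg [of "augment A b"] by (simp add: power_strict_mono)
  show "((min_singular_value A)\<^sup>2 - (min_singular_value (augment A b))\<^sup>2) * (norm u)\<^sup>2
      \<le> (norm (A *v u))\<^sup>2 - (min_singular_value (augment A b))\<^sup>2 * (norm u)\<^sup>2" for u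
    using min_singular_value_le_power2 [of A u] by (simp add: left_diff_distrib)
qed

text \<open>The solution for nearby data almost minimises the objective of \<open>(A, b)\<close>,
  and quadratic growth converts the excess in value into a distance.\<close>

lemma isCont_tls_solution:
  assumes gap: "min_singular_value (augment A b) < min_singular_value A"
  shows "isCont (\<lambda>q. tls_solution (fst q) (snd q)) (A, b)"
proof -
  let ?X = "\<lambda>q. tls_solution (fst q) (snd q)" and ?C = "\<lambda>q. augment (fst q) (snd q)"
  let ?\<tau> = "\<lambda>q. min_singular_value (?C q)" and ?p = "(A, b)"
  \<comment> \<open>\<open>\<epsilon> q\<close> bounds the excess of the objective of
    \<open>(A, b)\<close> at the solution for \<open>q\<close>; it is continuous and vanishes at
    \<open>(A, b)\<close>.\<close>
  define \<epsilon> where "\<epsilon> q = (?\<tau> q + norm (?C q - ?C ?p))\<^sup>2 - (?\<tau> ?p)\<^sup>2" for q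
  define c where "c = 1 + 2 * (norm (?X ?p))\<^sup>2"
  obtain \<delta> where \<delta>: "\<delta> > 0"
    "\<And>u. \<delta> * (norm u)\<^sup>2 \<le> (norm (A *v u))\<^sup>2 - (?\<tau> ?p)\<^sup>2 * (norm u)\<^sup>2"
    using tls_gap_coercive [OF gap] by auto
  have est: "\<delta> * (norm (?X q - ?X ?p))\<^sup>2 \<le> \<epsilon> q * (1 + (norm (?X q))\<^sup>2)"
    if "?\<tau> q < min_singular_value (fst q)" for q
  proof -
    let ?v = "vcat (?X q) (- 1 :: real ^ 1)"
    have "(norm (?C q *v ?v))\<^sup>2 = (?\<tau> q * norm ?v)\<^sup>2"
      using tls_objective_mult [of "fst q" "snd q" "?X q"]
      by (simp add: tls_objective_tls_solution [OF that] augment_mult_lift power_mult_distrib norm_lift)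
    then have "norm (?C q *v ?v) = ?\<tau> q * norm ?v"
      by (simp add: min_singular_value_nonneg)
    moreover have "?C ?p *v ?v = ?C q *v ?v - (?C q - ?C ?p) *v ?v"
      by (simp add: matrix_vector_mult_diff_rdistrib)
    ultimately have "norm (?C ?p *v ?v) \<le> (?\<tau> q + norm (?C q - ?C ?p)) * norm ?v"
      using norm_triangle_ineq4 [of "?C q *v ?v" "(?C q - ?C ?p) *v ?v"]
        frobenius_bound [of "?C q - ?C ?p" ?v] by (simp add: distrib_right)
    from power_mono [OF this norm_ge_zero, of 2]
    have "(norm (A *v ?X q - b))\<^sup>2 \<le> (?\<tau> q + norm (?C q - ?C ?p))\<^sup>2 * (1 + (norm (?X q))\<^sup>2)"
      by (simp add: augment_mult_lift power_mult_distrib norm_lift)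
    then have "(tls_objective A b (?X q) - (?\<tau> ?p)\<^sup>2) * (1 + (norm (?X q))\<^sup>2)
        \<le> \<epsilon> q * (1 + (norm (?X q))\<^sup>2)"
      by (simp add: left_diff_distrib tls_objective_mult \<epsilon>_def)
    with \<delta>(2) [of "?X q - ?X ?p"] tls_growth [OF tls_solution_min [OF gap], of "?X q"]
    show ?thesis by (simp add: tls_objective_tls_solution [OF gap])
  qed
  have "isCont \<epsilon> ?p"
    unfolding \<epsilon>_def
    by (intro continuous_intros isCont_o2 [OF _ isCont_min_singular_value]
        linear_continuous_at bounded_linear_augment)
  then have \<epsilon>0: "(\<epsilon> \<longlongrightarrow> 0) (at ?p)" by (simp add: isCont_def \<epsilon>_def)
  \<comment> \<open>The estimate \<open>est\<close> still contains \<open>norm (?X q)\<close>, for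
    which no bound is available yet. Below \<open>\<delta> / 4\<close>, its contribution is at most
    half of the left side and can be absorbed.\<close>
  have small: "\<forall>\<^sub>F q in at ?p. \<epsilon> q < \<delta> / 4"
    using \<epsilon>0 \<delta>(1) by (intro order_tendstoD) auto
  have gaps: "\<forall>\<^sub>F q in at ?p. ?\<tau> q < min_singular_value (fst q)"
    using eventually_tls_gap [OF gap] eventually_nhds_conv_at by blast
  have le: "\<forall>\<^sub>F q in at ?p. norm (?X q - ?X ?p) \<le> sqrt (2 * c / \<delta> * \<epsilon> q)"
    using small gaps
  proof eventually_elim
    case (elim q)
    let ?d = "?X q - ?X ?p"
    have pos: "0 \<le> \<epsilon> q * (1 + (norm (?X q))\<^sup>2)"
      using est [OF elim(2)] \<delta>(1) by (meson order_trans mult_nonneg_nonneg less_imp_le zero_le_power2)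
    then have \<epsilon>: "0 \<le> \<epsilon> q"
      using one_plus_norm_pos [of "?X q"] by (simp add: zero_le_mult_iff)
    have "norm (?X q) \<le> norm (?X ?p) + norm ?d"
      using norm_triangle_ineq [of "?X ?p" ?d] by simp
    then have "(norm (?X q))\<^sup>2 \<le> (norm (?X ?p) + norm ?d)\<^sup>2" by (simp add: power_mono)
    also have "\<dots> \<le> 2 * (norm (?X ?p))\<^sup>2 + 2 * (norm ?d)\<^sup>2"
      using sum_squares_bound [of "norm (?X ?p)" "norm ?d"] by (simp add: power2_sum)
    finally have "1 + (norm (?X q))\<^sup>2 \<le> c + 2 * (norm ?d)\<^sup>2" by (simp add: c_def)
    then have "\<epsilon> q * (1 + (norm (?X q))\<^sup>2) \<le> \<epsilon> q * (c + 2 * (norm ?d)\<^sup>2)"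
      using \<epsilon> by (intro mult_left_mono)
    moreover have "\<epsilon> q * (norm ?d)\<^sup>2 \<le> \<delta> / 4 * (norm ?d)\<^sup>2"
      using elim(1) by (intro mult_right_mono) auto
    ultimately have "\<delta> * (norm ?d)\<^sup>2 \<le> 2 * c * \<epsilon> q"
      using est [OF elim(2)] by (simp add: algebra_simps)
    then have "(norm ?d)\<^sup>2 \<le> 2 * c / \<delta> * \<epsilon> q" using \<delta>(1) by (simp add: field_simps)
    then show ?case by (rule real_le_rsqrt)
  qed
  have lim: "((\<lambda>q. sqrt (2 * c / \<delta> * \<epsilon> q)) \<longlongrightarrow> sqrt (2 * c / \<delta> * 0)) (at ?p)"
    by (intro tendsto_intros \<epsilon>0)
  have "((\<lambda>q. ?X q - ?X ?p) \<longlongrightarrow> 0) (at ?p)"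
    using Lim_null_comparison [OF le lim [unfolded mult_zero_right real_sqrt_zero]] .
  then show ?thesis by (simp only: isCont_def LIM_zero_iff)
qed

section \<open>Derivative of the solution\<close>

lemma matrix_inv_works:
  fixes M :: "real ^ 'n ^ 'n"
  assumes "\<And>u. M *v u = 0 \<Longrightarrow> u = 0"
  shows "matrix_inv M *v (M *v u) = u"
proof -
  have "invertible M"
    using assms matrix_left_invertible_ker [of M] by (auto simp: invertible_left_inverse)
  then have "M ** matrix_inv M = mat 1 \<and> matrix_inv M ** M = mat 1"
    unfolding invertible_def matrix_inv_def by (rule someI_ex)
  then show ?thesis by (simp add: matrix_vector_mul_assoc)
qed

text \<open>The multiplier is kept as the objective, a quotient of polynomials in data and unknown,
  so product and quotient rules apply. \<open>ds\<close> is the differential of the residual, and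
  the factor of the last \<open>x\<close> is that of the objective.\<close>

lemma tls_residual_has_derivative:
  fixes A :: "real ^ 'n ^ 'm" and x :: "real ^ 'n"
  assumes s: "s = A *v x - b" and w: "w = 1 + x \<bullet> x"
  shows "((\<lambda>(q, y). transpose (fst q) *v (fst q *v y - snd q) - tls_objective (fst q) (snd q) y *\<^sub>R y)
    has_derivative
      (\<lambda>(q, h). let ds = A *v h + fst q *v x - snd q in
        transpose A *v ds + transpose (fst q) *v s
        - (tls_objective A b x *\<^sub>R h + (2 * (s \<bullet> ds) / w - s \<bullet> s * (2 * (x \<bullet> h)) / w\<^sup>2) *\<^sub>R x)))
    (at ((A, b), x))"
proof -
  let ?S = "\<lambda>z. fst (fst z) *v snd z - snd (fst z)"
  let ?ds = "\<lambda>z. A *v snd z + fst (fst z) *v x - snd (fst z)"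
  have S: "(?S has_derivative ?ds) (at ((A, b), x))"
    by (rule has_derivative_eq_rhs, (rule derivative_eq_intros
          bounded_bilinear.FDERIV [OF bounded_bilinear_matrix_vector_mult] refl)+) auto
  have T: "((\<lambda>z. transpose (fst (fst z))) has_derivative (\<lambda>z. transpose (fst (fst z)))) (at ((A, b), x))"
    by (intro bounded_linear.has_derivative [OF bounded_linear_transpose] derivative_intros)
  have "w \<noteq> 0" using one_plus_norm_pos [of x] by (simp add: w power2_norm_eq_inner)
  then have obj: "((\<lambda>z. ?S z \<bullet> ?S z / (1 + snd z \<bullet> snd z)) has_derivative
      (\<lambda>z. 2 * (s \<bullet> ?ds z) / w - s \<bullet> s * (2 * (x \<bullet> snd z)) / w\<^sup>2)) (at ((A, b), x))"
  proof -
    have num: "((\<lambda>z. ?S z \<bullet> ?S z) has_derivative (\<lambda>z. 2 * (s \<bullet> ?ds z))) (at ((A, b), x))"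
      by (rule has_derivative_eq_rhs [OF has_derivative_inner [OF S S]])
         (simp add: fun_eq_iff inner_commute [of _ s] flip: s)
    have den: "((\<lambda>z. 1 + snd z \<bullet> snd z) has_derivative (\<lambda>z. 2 * (x \<bullet> snd z))) (at ((A, b), x))"
      by (auto intro!: derivative_eq_intros simp: fun_eq_iff inner_commute [of _ x])
    show ?thesis
      by (rule has_derivative_eq_rhs [OF has_derivative_divide' [OF num den]])
         (use \<open>w \<noteq> 0\<close> in \<open>simp_all add: fun_eq_iff diff_divide_distrib power2_eq_square flip: s w\<close>)
  qed
  have "((\<lambda>z. transpose (fst (fst z)) *v ?S z - (?S z \<bullet> ?S z / (1 + snd z \<bullet> snd z)) *\<^sub>R snd z)
    has_derivative (\<lambda>z. transpose A *v ?ds z + transpose (fst (fst z)) *v s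
        - ((s \<bullet> s / w) *\<^sub>R snd z + (2 * (s \<bullet> ?ds z) / w - s \<bullet> s * (2 * (x \<bullet> snd z)) / w\<^sup>2) *\<^sub>R x)))
    (at ((A, b), x))"
    by (rule has_derivative_eq_rhs, (rule has_derivative_diff has_derivative_scaleR
          has_derivative_snd has_derivative_ident obj T S
          bounded_bilinear.FDERIV [OF bounded_bilinear_matrix_vector_mult])+)
       (simp add: s [symmetric] w [symmetric])
  then show ?thesis
    by (simp only: tls_objective_def power2_norm_eq_inner case_prod_beta' Let_def s [symmetric]
        w [symmetric])
qed

lemma tls_solution_has_derivative:
  fixes A :: "real ^ 'n ^ 'm"
  assumes gap: "min_singular_value (augment A b) < min_singular_value A"
    and Mt: "Mt = transpose A ** A - (min_singular_value (augment A b))\<^sup>2 *\<^sub>R mat 1"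
    and x: "x = matrix_inv Mt *v (transpose A *v b)"
    and r: "r = b - A *v x"
  shows "tls_solution A b = x"
    and "((\<lambda>q. tls_solution (fst q) (snd q)) has_derivative
      (\<lambda>(dA, db). matrix_inv Mt *v (transpose dA *v r + transpose A *v (db - dA *v x)
        + (2 / (1 + (norm x)\<^sup>2) * (r \<bullet> (db - dA *v x))) *\<^sub>R x))) (at (A, b))"
proof -
  let ?X = "\<lambda>q. tls_solution (fst q) (snd q)" and ?\<tau> = "min_singular_value (augment A b)"
  define y where "y = tls_solution A b"
  define s where "s = A *v y - b"
  define w where "w = 1 + y \<bullet> y"
  have Mt_mult: "Mt *v u = transpose A *v (A *v u) - ?\<tau>\<^sup>2 *\<^sub>R u" for u
    by (simp add: Mt matrix_vector_mult_diff_rdistrib matrix_vector_mul_assoc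
        scaleR_matrix_vector_assoc [symmetric])
  have obj: "tls_objective A b y = ?\<tau>\<^sup>2"
    unfolding y_def by (rule tls_objective_tls_solution [OF gap])
  have stat: "transpose A *v s = ?\<tau>\<^sup>2 *\<^sub>R y"
    using tls_stationary [OF tls_solution_min [OF gap]] by (simp add: obj s_def flip: y_def)
  obtain \<delta> where \<delta>: "\<delta> > 0"
    "\<And>u. \<delta> * (norm u)\<^sup>2 \<le> (norm (A *v u))\<^sup>2 - ?\<tau>\<^sup>2 * (norm u)\<^sup>2"
    using tls_gap_coercive [OF gap] by auto
  \<comment> \<open>Pairing \<open>Mt *v u\<close> with \<open>u\<close> gives the coercive
    quadratic form.\<close>
  have ker: "u = 0" if "Mt *v u = 0" for u
  proof -
    have "(Mt *v u) \<bullet> u = (norm (A *v u))\<^sup>2 - ?\<tau>\<^sup>2 * (norm u)\<^sup>2"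
      unfolding power2_norm_eq_inner Mt_mult inner_diff_left transpose_inner by simp
    with that \<delta>(2) [of u] have "\<delta> * (norm u)\<^sup>2 \<le> 0" by simp
    with \<delta>(1) show "u = 0" by (simp add: mult_le_0_iff)
  qed
  have inv: "matrix_inv Mt *v (Mt *v u) = u" for u
    by (rule matrix_inv_works) (rule ker)
  \<comment> \<open>Stationarity, solved for the terms in \<open>y\<close>, is the linear system
    behind the closed formula for \<open>x\<close>.\<close>
  have "Mt *v y = transpose A *v b"
    using stat by (simp add: Mt_mult s_def matrix_vector_mult_diff_distrib algebra_simps)
  then have yx: "y = x" using inv [of y] by (simp add: x)
  then show "tls_solution A b = x" by (simp add: y_def)
  let ?F = "\<lambda>(q, y). transpose (fst q) *v (fst q *v y - snd q)
    - tls_objective (fst q) (snd q) y *\<^sub>R y"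
  let ?F' = "\<lambda>(q, h). let ds = A *v h + fst q *v y - snd q in
        transpose A *v ds + transpose (fst q) *v s
        - (tls_objective A b y *\<^sub>R h + (2 * (s \<bullet> ds) / w - s \<bullet> s * (2 * (y \<bullet> h)) / w\<^sup>2) *\<^sub>R y)"
  have "w > 0" using one_plus_norm_pos [of y] by (simp add: w_def power2_norm_eq_inner)
  have ss: "s \<bullet> s = ?\<tau>\<^sup>2 * w"
    using tls_objective_mult [of A b y] by (simp add: obj s_def w_def power2_norm_eq_inner)
  have "(?X has_derivative (\<lambda>h. - (matrix_inv Mt *v ?F' (h, 0)))) (at (A, b))"
  proof (rule has_derivative_implicit_function
      [where F = ?F and F' = ?F' and T = "(*v) (matrix_inv Mt)"])
    show "(?F has_derivative ?F') (at ((A, b), ?X (A, b)))"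
      using tls_residual_has_derivative [OF s_def w_def] by (simp add: y_def)
    show "bounded_linear ((*v) (matrix_inv Mt))" by simp
    show "matrix_inv Mt *v ?F' (0, h) = h" for h
    proof -
      \<comment> \<open>The objective is stationary at \<open>y\<close>, so only \<open>Mt\<close> remains of the derivative in \<open>y\<close>.\<close>
      have "s \<bullet> (A *v h) = ?\<tau>\<^sup>2 * (y \<bullet> h)"
        using stat transpose_inner [of A s h] by simp
      then have "2 * (s \<bullet> (A *v h)) / w - s \<bullet> s * (2 * (y \<bullet> h)) / w\<^sup>2 = 0"
        using \<open>w > 0\<close> by (simp add: ss power2_eq_square)
      moreover have "transpose 0 *v s = 0" by (simp add: transpose_def vec_eq_iff matrix_vector_mult_def)
      ultimately have "?F' (0, h) = Mt *v h"
        by (simp add: obj Mt_mult)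
      then show ?thesis by (simp only: inv)
    qed
    show "isCont ?X (A, b)" by (rule isCont_tls_solution [OF gap])
    show "\<forall>\<^sub>F q in nhds (A, b). ?F (q, ?X q) = 0"
      using eventually_tls_gap [OF gap]
    proof eventually_elim
      case (elim q)
      then show ?case using tls_stationary [OF tls_solution_min [OF elim]] by simp
    qed
  qed
  \<comment> \<open>For a pure data direction the derivative of the denominator vanishes, and
    \<open>s = - r\<close> accounts for the signs.\<close>
  moreover have "- (matrix_inv Mt *v ?F' ((dA, db), 0)) =
      matrix_inv Mt *v (transpose dA *v r + transpose A *v (db - dA *v x)
        + (2 / (1 + (norm x)\<^sup>2) * (r \<bullet> (db - dA *v x))) *\<^sub>R x)" for dA db
  proof -
    let ?e = "db - dA *v x"
    note minus = bounded_bilinear.minus_right [OF bounded_bilinear_matrix_vector_mult]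
    have sr: "s = - r" by (simp add: s_def r yx)
    have wx: "w = 1 + (norm x)\<^sup>2" by (simp add: w_def yx power2_norm_eq_inner)
    have de: "dA *v x - db = - ?e" by simp
    have "?F' ((dA, db), 0) = - (transpose dA *v r + transpose A *v ?e
        + (2 / (1 + (norm x)\<^sup>2) * (r \<bullet> ?e)) *\<^sub>R x)"
      by (simp add: sr yx de wx minus del: minus_diff_eq transpose_matrix_vector)
    then show ?thesis by (simp only: minus minus_minus)
  qed
  ultimately show "(?X has_derivative
      (\<lambda>(dA, db). matrix_inv Mt *v (transpose dA *v r + transpose A *v (db - dA *v x)
        + (2 / (1 + (norm x)\<^sup>2) * (r \<bullet> (db - dA *v x))) *\<^sub>R x))) (at (A, b))"
    by (simp add: case_prod_beta')
qed


section \<open>The condition numbers\<close>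

lemma infnorm_le_iff:
  fixes v :: "real ^ 'n"
  shows "infnorm v \<le> c \<longleftrightarrow> (\<forall>i. \<bar>v $ i\<bar> \<le> c)"
proof
  show "\<forall>i. \<bar>v $ i\<bar> \<le> c" if "infnorm v \<le> c"
    using that component_le_infnorm_cart order_trans by blast
  show "infnorm v \<le> c" if "\<forall>i. \<bar>v $ i\<bar> \<le> c"
    unfolding infnorm_cart by (rule cSup_least) (use that in auto)
qed

lemma infnorm_attained:
  fixes v :: "real ^ 'n"
  shows "\<exists>i. infnorm v = \<bar>v $ i\<bar>"
proof -
  have "infnorm v = Max (range (\<lambda>i. \<bar>v $ i\<bar>))"
    by (intro antisym) (auto simp: infnorm_le_iff component_le_infnorm_cart)
  moreover have "Max (range (\<lambda>i. \<bar>v $ i\<bar>)) \<in> range (\<lambda>i. \<bar>v $ i\<bar>)" by (intro Max_in) auto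
  ultimately show ?thesis by (metis imageE)
qed

lemma vec_div_component: "vec_div a v $ i = ddag (v $ i) * a $ i"
  by (simp add: vec_div_def diag_ddag_def matrix_vector_mult_def
      if_distrib [of "\<lambda>c. c * _"] cong: if_cong)

text \<open>Division by a constant vector is scaling by one nonnegative number, also when
  \<open>infnorm y\<close> is 0, where \<open>ddag\<close> is 1.\<close>

lemma infnorm_vec_div_const: "infnorm (vec_div v (\<chi> i. infnorm y)) = scal_div (infnorm v) (infnorm y)"
proof -
  have "vec_div v (\<chi> i. infnorm y) = ddag (infnorm y) *\<^sub>R v"
    by (simp add: vec_eq_iff vec_div_component)
  moreover have "0 \<le> ddag (infnorm y)" by (simp add: ddag_def infnorm_pos_le)
  ultimately show ?thesis by (simp add: infnorm_mul scal_div_def)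
qed

lemma infnorm_vec_div_abs: "infnorm (vec_div v \<bar>y\<bar>) = infnorm (vec_div v y)"
proof -
  have "\<bar>vec_div v \<bar>y\<bar> $ i\<bar> = \<bar>vec_div v y $ i\<bar>" for i
    by (simp add: vec_div_component abs_mult ddag_def abs_vec_def)
  then show ?thesis by (simp add: infnorm_cart)
qed

text \<open>Relative perturbations \<open>z\<close> turn the derivative into \<open>K\<close> with
  columns scaled by the data, whose maximum norm is its largest absolute row sum, weighted by
  \<open>\<xi>\<close>.\<close>

lemma kappa_eq:
  fixes A :: "real ^ 'n ^ 'm" and K :: "real ^ (('n \<times> 'm) + 'm) ^ 'k"
  assumes deriv: "(tls_map L has_derivative (\<lambda>(dA, db). K *v vec_of_pair dA db)) (at (A, b))"
    and nz: "vec_of_pair A b \<noteq> 0"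
  shows "kappa L A b \<xi> = infnorm (vec_div (\<bar>K\<bar> *v \<bar>vec_of_pair A b\<bar>) \<xi>)"
proof -
  let ?w = "vec_of_pair A b"
  let ?R = "infnorm (vec_div (\<bar>K\<bar> *v \<bar>?w\<bar>) \<xi>)"
  let ?z = "\<lambda>dA db. vec_of_pair (mat_div dA A) (vec_div db b)"
  let ?q = "\<lambda>(dA, db). infnorm (vec_div (K *v vec_of_pair dA db) \<xi>) / infnorm (?z dA db)"
  have comp: "(\<bar>K\<bar> *v \<bar>?w\<bar>) $ i = (\<Sum>p\<in>UNIV. \<bar>K $ i $ p * ?w $ p\<bar>)" for i
    by (simp add: matrix_vector_mult_def abs_mult abs_vec_def)
  have R: "\<bar>ddag (\<xi> $ i)\<bar> * (\<Sum>p\<in>UNIV. \<bar>K $ i $ p * ?w $ p\<bar>) \<le> ?R" for i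
    using component_le_infnorm_cart [of "vec_div (\<bar>K\<bar> *v \<bar>?w\<bar>) \<xi>" i]
    by (simp add: vec_div_component comp abs_mult sum_nonneg)
  have upper: "?q (dA, db) \<le> ?R" if "(dA, db) \<in> admissible_perturbations A b" for dA db
  proof -
    \<comment> \<open>Where the data entry is 0, admissibility makes the perturbation entry 0 as
      well, so the convention of \<open>ddag\<close> does no harm.\<close>
    have y: "vec_of_pair dA db $ p = ?w $ p * ?z dA db $ p" for p
      using that by (cases p) (auto simp: admissible_perturbations_def vec_of_pair_def vcat_def
          vec_of_mat_def mat_div_def vec_div_component ddag_def)
    have "infnorm (vec_div (K *v vec_of_pair dA db) \<xi>) \<le> ?R * infnorm (?z dA db)"
      unfolding infnorm_le_iff
    proof
      fix i
      have "\<bar>(K *v vec_of_pair dA db) $ i\<bar> \<le> (\<Sum>p\<in>UNIV. \<bar>K $ i $ p * vec_of_pair dA db $ p\<bar>)"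
        by (simp add: matrix_vector_mult_def)
      also have "\<dots> \<le> (\<Sum>p\<in>UNIV. \<bar>K $ i $ p * ?w $ p\<bar> * infnorm (?z dA db))"
        by (intro sum_mono) (simp add: y abs_mult mult.assoc mult_left_mono component_le_infnorm_cart)
      finally have "\<bar>vec_div (K *v vec_of_pair dA db) \<xi> $ i\<bar>
          \<le> \<bar>ddag (\<xi> $ i)\<bar> * ((\<Sum>p\<in>UNIV. \<bar>K $ i $ p * ?w $ p\<bar>) * infnorm (?z dA db))"
        by (simp add: vec_div_component abs_mult mult_left_mono sum_distrib_right)
      also have "\<dots> \<le> ?R * infnorm (?z dA db)"
        using mult_right_mono [OF R [of i] infnorm_pos_le] by (simp add: mult.assoc)
      finally show "\<bar>vec_div (K *v vec_of_pair dA db) \<xi> $ i\<bar> \<le> ?R * infnorm (?z dA db)" .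
    qed
    moreover have "infnorm (?z dA db) > 0"
      using that infnorm_pos_le [of "?z dA db"] by (auto simp: admissible_perturbations_def)
    ultimately show ?thesis by (simp add: pos_divide_le_eq)
  qed
  obtain i where i: "?R = \<bar>vec_div (\<bar>K\<bar> *v \<bar>?w\<bar>) \<xi> $ i\<bar>" using infnorm_attained by blast
  \<comment> \<open>Relative perturbations of size 1 whose signs make every term of the maximal row
    \<open>i\<close> nonnegative.\<close>
  define s :: "('n \<times> 'm) + 'm \<Rightarrow> real" where "s p = (if K $ i $ p * ?w $ p \<ge> 0 then 1 else - 1)" for p
  define dA :: "real ^ 'n ^ 'm" where "dA = (\<chi> i j. A $ i $ j * s (Inl (j, i)))"
  define db :: "real ^ 'm" where "db = (\<chi> i. b $ i * s (Inr i))"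
  have y: "vec_of_pair dA db $ p = ?w $ p * s p" for p
    by (cases p) (auto simp: dA_def db_def vec_of_pair_def vcat_def vec_of_mat_def)
  have z: "?z dA db $ p = (if ?w $ p = 0 then 0 else s p)" for p
    by (cases p) (auto simp: dA_def db_def vec_of_pair_def vcat_def vec_of_mat_def mat_div_def
        vec_div_component ddag_def)
  have z1: "infnorm (?z dA db) = 1"
  proof (rule antisym)
    show "infnorm (?z dA db) \<le> 1" by (simp add: infnorm_le_iff z s_def)
    \<comment> \<open>A nonzero data entry keeps the relative perturbation from vanishing, as zero
      data entries contribute 0.\<close>
    obtain p where "?w $ p \<noteq> 0" using nz by (auto simp: vec_eq_iff)
    then show "1 \<le> infnorm (?z dA db)"
      using component_le_infnorm_cart [of "?z dA db" p] by (auto simp: z s_def split: if_splits)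
  qed
  have mem: "(dA, db) \<in> admissible_perturbations A b"
    by (simp add: admissible_perturbations_def z1) (simp add: dA_def db_def)
  have "(K *v vec_of_pair dA db) $ i = (\<bar>K\<bar> *v \<bar>?w\<bar>) $ i"
    unfolding comp by (auto simp: matrix_vector_mult_def y s_def intro!: sum.cong)
  then have "?R \<le> ?q (dA, db)"
    using component_le_infnorm_cart [of "vec_div (K *v vec_of_pair dA db) \<xi>" i]
    by (simp add: z1 i vec_div_component)
  with upper [OF mem] have "?q (dA, db) = ?R" by simp
  then have "Sup (?q ` admissible_perturbations A b) = ?R"
    using mem upper by (intro cSup_eq_maximum) force+
  then show ?thesis
    unfolding kappa_def frechet_derivative_at [OF deriv, symmetric] by simp
qed

section \<open>The Jacobian in Kronecker form\<close>

lemma hcat_mult_vcat: "hcat M N *v vcat u v = M *v u + N *v v"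
  by (simp add: vec_eq_iff matrix_vector_mult_def hcat_def vcat_def sum_UNIV_Plus)

text \<open>The case of a single row \<open>v\<close> of the classical identity expressing the
  vectorisation of a triple product through a Kronecker product.\<close>

lemma row_kronecker_mult_vec: "row_kronecker v C *v vec_of_mat X = C *v (X *v v)"
proof -
  have "(row_kronecker v C *v vec_of_mat X) $ k = (C *v (X *v v)) $ k" for k
  proof -
    have "(row_kronecker v C *v vec_of_mat X) $ k
        = (\<Sum>j\<in>UNIV. \<Sum>i\<in>UNIV. v $ j * C $ k $ i * X $ i $ j)"
      by (simp add: matrix_vector_mult_def row_kronecker_def kronecker_def rowvector_def
          vec_of_mat_def sum.cartesian_product UNIV_Times_UNIV case_prod_beta)
    also have "\<dots> = (\<Sum>i\<in>UNIV. \<Sum>j\<in>UNIV. v $ j * C $ k $ i * X $ i $ j)"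
      by (rule sum.swap)
    also have "\<dots> = (C *v (X *v v)) $ k"
      by (simp add: matrix_vector_mult_def sum_distrib_left mult_ac)
    finally show ?thesis .
  qed
  then show ?thesis by (simp add: vec_eq_iff)
qed

lemma outer_product_mult:
  "(columnvector u :: real ^ 1 ^ 'n) *v (rowvector v *v y) = (v \<bullet> y) *\<^sub>R (u :: real ^ 'n)"
  by (simp add: vec_eq_iff matrix_vector_mult_def columnvector_def
      rowvector_def inner_vec_def sum_distrib_left mult_ac)

theorem mainTheorem7:
  fixes A :: "real ^ 'n ^ 'm" and b :: "real ^ 'm" and L :: "real ^ 'k ^ 'n"
    and \<sigma> \<sigma>t :: real and Mt :: "real ^ 'n ^ 'n" and x :: "real ^ 'n" and r :: "real ^ 'm"
    and D :: "real ^ 'm ^ 'k" and K :: "real ^ (('n \<times> 'm) + 'm) ^ 'k"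
  assumes "CARD('n) \<le> CARD('m)"
    and "CARD('k) \<le> CARD('n)"
    and "\<sigma> = min_singular_value A"
    and "\<sigma>t = min_singular_value (augment A b)"
    and "\<sigma>t < \<sigma>"
    and "Mt = transpose A ** A - \<sigma>t\<^sup>2 *\<^sub>R mat 1"
    and "x = matrix_inv Mt *v (transpose A *v b)"
    and "r = b - A *v x"
    and "D = transpose L ** matrix_inv Mt **
      (transpose A + (2 / (1 + (norm x)\<^sup>2)) *\<^sub>R ((columnvector x :: real ^ 1 ^ 'n) ** rowvector r))"
    and "K = hcat (row_kronecker r (transpose L ** matrix_inv Mt) ** vec_perm - row_kronecker x D) D"
  shows "kappa_mTLS L A b =
      scal_div (infnorm (\<bar>K\<bar> *v \<bar>vec_of_pair A b\<bar>)) (infnorm (transpose L *v tls_solution A b))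
    \<and> kappa_cTLS L A b =
      infnorm (vec_div (\<bar>K\<bar> *v \<bar>vec_of_pair A b\<bar>) \<bar>transpose L *v tls_solution A b\<bar>)"
proof -
  have gap: "min_singular_value (augment A b) < min_singular_value A" using assms by simp
  let ?P = "transpose L ** matrix_inv Mt"
  have D: "D *v y = ?P *v (transpose A *v y + (2 / (1 + (norm x)\<^sup>2) * (r \<bullet> y)) *\<^sub>R x)" for y
    by (simp only: assms(9) matrix_vector_mul_assoc [symmetric] matrix_vector_mult_add_rdistrib
        scaleR_matrix_vector_assoc [symmetric] outer_product_mult scaleR_scaleR)
  \<comment> \<open>\<open>vec_perm\<close> produces \<open>transpose dA\<close> in the first block,
    and the two occurrences of \<open>D\<close> combine into \<open>D *v (db - dA *v x)\<close>;
    this is the derivative of \<open>tls_map L\<close>.\<close>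
  have K: "K *v vec_of_pair dA db = transpose L *v (matrix_inv Mt *v
      (transpose dA *v r + transpose A *v (db - dA *v x)
        + (2 / (1 + (norm x)\<^sup>2) * (r \<bullet> (db - dA *v x))) *\<^sub>R x))" for dA db
  proof -
    have "K *v vec_of_pair dA db = ?P *v (transpose dA *v r) + D *v (db - dA *v x)"
      by (simp only: assms(10) vec_of_pair_def hcat_mult_vcat matrix_vector_mult_diff_rdistrib
          matrix_vector_mul_assoc [symmetric, where x = "vec_of_mat dA"] vec_perm_mult
          row_kronecker_mult_vec matrix_vector_mult_diff_distrib) simp
    then show ?thesis
      by (simp only: D matrix_vector_mul_assoc matrix_mul_assoc matrix_vector_right_distrib add.assoc)
  qed
  have "tls_map L = (\<lambda>q :: (real ^ 'n ^ 'm) \<times> (real ^ 'm). transpose L *v tls_solution (fst q) (snd q))"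
    by (simp add: tls_map_def case_prod_beta')
  moreover have "((\<lambda>q. transpose L *v tls_solution (fst q) (snd q)) has_derivative
      (\<lambda>q. transpose L *v (case q of (dA, db) \<Rightarrow> matrix_inv Mt *v
        (transpose dA *v r + transpose A *v (db - dA *v x)
        + (2 / (1 + (norm x)\<^sup>2) * (r \<bullet> (db - dA *v x))) *\<^sub>R x)))) (at (A, b))"
    by (intro bounded_linear.has_derivative [OF matrix_vector_mul_bounded_linear]
        tls_solution_has_derivative(2) [OF gap assms(6) [unfolded assms(4)] assms(7,8)])
  ultimately have deriv:
    "(tls_map L has_derivative (\<lambda>(dA, db). K *v vec_of_pair dA db)) (at (A, b))"
    by (simp only: K case_prod_beta')
  \<comment> \<open>Zero data would give \<open>A\<close> the smallest singular value 0, leaving no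
    room for the gap.\<close>
  have "vec_of_pair A b \<noteq> 0"
  proof
    assume zero: "vec_of_pair A b = 0"
    have "A $ i $ j = vec_of_pair A b $ Inl (j, i)" for i j
      by (simp add: vec_of_pair_def vcat_def vec_of_mat_def)
    with zero have "A = 0" by (simp add: vec_eq_iff)
    then have "min_singular_value A = 0"
      using min_singular_value_attained [of A] by simp
    with gap min_singular_value_nonneg [of "augment A b"] show False by simp
  qed
  from kappa_eq [OF deriv this] show ?thesis
    by (simp add: kappa_mTLS_def kappa_cTLS_def infnorm_vec_div_const infnorm_vec_div_abs)
qed

end
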